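(* Let $a,b,c,d$ be nonnegative integers with $a+d\ge 1$, $b,c\ge 1$ and $\gcd(b,c,a+d)=1$, and let $m,q\ge 0$ be integers. Let $\xi_{m+q}$ denote the smallest positive root of $1-4z^{a+d}\sum_{j=0}^{m+q-1}z^{bj}$. Then the number $L_{m,q,n}$ of $m$-open lambda terms with exactly $q$ abstractions and size $n$ is $0$ if $m=q=0$ or if $n$ is any positive integer that cannot be expressed in the form $(y+1)a+xb+qc+yd$ with nonnegative integers $x,y$ satisfying $x\le (m-1+q)(y+1)$; otherwise its asymptotic value is $$L_{m,q,n}\sim C\,\frac{\xi_{m+q}^{-n}}{2\sqrt{\pi n^3}}\qquad\text{as } n\to\infty,$$ where $$C=\frac{\xi_{m+q}^{cq-d}\sqrt{\xi_{m+q}^{a+d}\sum_{j=0}^{m+q-1}(a+d+bj)\,\xi_{m+q}^{bj}}}{\prod_{i=0}^{q-1}\delta_{m+i}(\xi_{m+q})}.$$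
   Context: Lambda terms (in De Bruijn notation) are the formal expressions generated by $M::= S^k0\ (k\ge 0)\mid \lambda M\mid (M\,M)$, where $S^k0$ is a De Bruijn index (a string of $k$ successors $S$ followed by a zero $0$, representing the index $k+1$), $\lambda M$ is an abstraction and $(M\,M)$ an application. An occurrence of $S^k0$ in a term is bound if it lies in the scope of at least $k+1$ abstractions, otherwise it is free. A term is closed if it has no free index. For an integer $m\ge0$, a term is $m$-open if prefixing it with $m$ abstractions gives a closed term. The size $|\cdot|$ is defined by $|0|=a$, $|Sn|=|n|+b$, $|\lambda M|=|M|+c$, $|M\,N|=|M|+|N|+d$. For $k\ge 0$, $\delta_k(z)=\sqrt{1-4z^{a+d}\sum_{j=0}^{k-1}z^{bj}}$ (so $\delta_0=1$).
   Formalization: The asymptotic value is multiplied by the gcd of a+d+bj for 0≤j<m+q (the factor is 1 in the aperiodic case); without it the claim fails, e.g. a=b=c=d=1, m=1, q=0 is off by a factor 2. The limit runs over expressible n, and the vanishing claim is for n>0. *)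

theory Defs
  imports Complex_Main "HOL-Library.Landau_Symbols"
begin

text \<open>
  \<^term>\<open>Ind k\<close> is the De Bruijn index \<open>S\<close>\<open>k\<close>\<open>0\<close>, i.e. \<open>k\<close> successors applied to \<open>0\<close>;
  counted from 1 it is the index \<open>k + 1\<close>.
\<close>

datatype lterm = Ind nat | Lam lterm | App lterm lterm

text \<open>
  \<open>has_free l M\<close>: some occurrence of an index in \<open>M\<close> is free when \<open>M\<close> is placed under \<open>l\<close>
  abstractions. An occurrence of \<open>Ind k\<close> is bound iff it lies in the scope of at least \<open>k + 1\<close>
  abstractions.
\<close>

primrec has_free :: "nat \<Rightarrow> lterm \<Rightarrow> bool" where
  "has_free l (Ind k) \<longleftrightarrow> \<not> k + 1 \<le> l"
| "has_free l (Lam M) \<longleftrightarrow> has_free (Suc l) M"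
| "has_free l (App M N) \<longleftrightarrow> has_free l M \<or> has_free l N"

definition closed_term :: "lterm \<Rightarrow> bool" where
  "closed_term M \<longleftrightarrow> \<not> has_free 0 M"

definition m_open :: "nat \<Rightarrow> lterm \<Rightarrow> bool" where
  "m_open m M \<longleftrightarrow> closed_term ((Lam ^^ m) M)"

primrec term_size :: "nat \<Rightarrow> nat \<Rightarrow> nat \<Rightarrow> nat \<Rightarrow> lterm \<Rightarrow> nat" where
  "term_size a b c d (Ind k) = a + k * b"
| "term_size a b c d (Lam M) = term_size a b c d M + c"
| "term_size a b c d (App M N) = term_size a b c d M + term_size a b c d N + d"

primrec abstractions :: "lterm \<Rightarrow> nat" where
  "abstractions (Ind k) = 0"
| "abstractions (Lam M) = abstractions M + 1"
| "abstractions (App M N) = abstractions M + abstractions N"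

text \<open>The set counted here is finite whenever \<open>a + d \<ge> 1\<close> and \<open>b \<ge> 1\<close>.\<close>

definition L :: "nat \<Rightarrow> nat \<Rightarrow> nat \<Rightarrow> nat \<Rightarrow> nat \<Rightarrow> nat \<Rightarrow> nat \<Rightarrow> nat" where
  "L a b c d m q n =
     card {M. m_open m M \<and> abstractions M = q \<and> term_size a b c d M = n}"

definition radicand :: "nat \<Rightarrow> nat \<Rightarrow> nat \<Rightarrow> nat \<Rightarrow> real \<Rightarrow> real" where
  "radicand a b d k z = 1 - 4 * z ^ (a + d) * (\<Sum>j<k. z ^ (b * j))"

definition \<delta> :: "nat \<Rightarrow> nat \<Rightarrow> nat \<Rightarrow> nat \<Rightarrow> real \<Rightarrow> real" where
  "\<delta> a b d k z = sqrt (radicand a b d k z)"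

text \<open>
  For \<open>a + d \<ge> 1\<close> a positive root exists, and is unique, iff \<open>k \<ge> 1\<close>; the value at \<open>k = 0\<close> is
  unspecified.
\<close>

definition \<xi> :: "nat \<Rightarrow> nat \<Rightarrow> nat \<Rightarrow> nat \<Rightarrow> real" where
  "\<xi> a b d k = (LEAST z. 0 < z \<and> radicand a b d k z = 0)"

text \<open>
  The bound on \<open>x\<close> is over the integers: for \<open>m = q = 0\<close> its right-hand side is negative.
\<close>

definition expressible :: "nat \<Rightarrow> nat \<Rightarrow> nat \<Rightarrow> nat \<Rightarrow> nat \<Rightarrow> nat \<Rightarrow> nat \<Rightarrow> bool" where
  "expressible a b c d m q n \<longleftrightarrow>
     (\<exists>x y :: nat. n = (y + 1) * a + x * b + q * c + y * d \<and>
                   int x \<le> (int m - 1 + int q) * (int y + 1))"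

definition C :: "nat \<Rightarrow> nat \<Rightarrow> nat \<Rightarrow> nat \<Rightarrow> nat \<Rightarrow> nat \<Rightarrow> real" where
  "C a b c d m q = (let z = \<xi> a b d (m + q) in
     z powi (int (c * q) - int d) *
     sqrt (z ^ (a + d) * (\<Sum>j<m + q. real (a + d + b * j) * z ^ (b * j))) /
     (\<Prod>i<q. \<delta> a b d (m + i) z))"

text \<open>
  Greatest common divisor of the exponents of \<open>z\<close> in
  \<open>\<Sum>j<k. z ^ (a + d + b * j)\<close>: it is \<open>a + d\<close> for \<open>k = 1\<close> and \<open>gcd (a + d) b\<close> for \<open>k \<ge> 2\<close>.
  The expressible sizes all lie in one residue class modulo \<open>period a b d (m + q)\<close> and, from some
  point on, exhaust it. Since \<^term>\<open>radicand a b d k z\<close>, read over the complex numbers, has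
  \<open>period a b d k\<close> roots of modulus \<^term>\<open>\<xi> a b d k\<close>, whose contributions to the counting sequence
  are equal on that class and cancel off it, the asymptotics along the class carries this
  multiplicity.
\<close>

definition period :: "nat \<Rightarrow> nat \<Rightarrow> nat \<Rightarrow> nat \<Rightarrow> nat" where
  "period a b d k = Gcd ((\<lambda>j. a + d + b * j) ` {..<k})"

end

theory Submission
  imports Defs "HOL-Complex_Analysis.Complex_Analysis" "HOL-Real_Asymp.Real_Asymp"
begin

text \<open>
  A term with \<open>y\<close> applications has \<open>y + 1\<close> indices, and in an \<open>m\<close>-open term with \<open>q\<close>
  abstractions each index is below \<open>m + q\<close>; hence every size that occurs is expressible.

  For the asymptotics, let \<open>K = m + q > 0\<close>. Adding \<open>d\<close> to the size of a term charges \<open>a + d\<close> to each index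
  \<open>0\<close>, \<open>b\<close> to each successor and \<open>c\<close> to each of the \<open>q\<close> abstractions, so the abstractions only
  shift the counting sequence and \<open>a\<close>, \<open>d\<close> enter through \<open>a + d\<close>. The weights \<open>a + d + b * j\<close>
  (\<open>j < K\<close>) of the indices are then divided by their greatest common divisor \<open>p\<close>. This
  replaces one residue class modulo \<open>p\<close> by all natural numbers, so that afterwards there is a single
  dominant singularity. The factor \<open>p\<close> of the final formula is \<open>p powr (3 / 2)\<close>, from rewriting
  \<open>(n / p) powr (- 3 / 2)\<close>, times \<open>1 / sqrt p\<close>, from the rescaled sum under the root in \<open>C\<close>.

  In the reduced situation, with weights again denoted \<open>a + b * j\<close>, write \<open>P k z = (\<Sum>j<k. z ^ (a + b * j))\<close> and let
  \<open>T m q\<close> be the generating function. Splitting terms at the root gives \<open>T m 0 = P m + T m 0 ^ 2\<close>, so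
  \<open>D m = 1 - 2 * T m 0\<close> is a square root of \<open>1 - 4 * P m\<close>, and for \<open>q > 0\<close> it gives a linear equation
  for \<open>T m q\<close> with leading coefficient \<open>D m\<close>. Let \<open>\<rho>\<close> be the positive root of \<open>1 - 4 * P K\<close>.
  The series \<open>D k\<close> with \<open>k < K\<close> are analytic and free of zeros in a disc of radius larger than \<open>\<rho>\<close>, and
  unfolding the linear equation shows that up to such analytic terms
  \<open>T m q\<close> is \<open>T K 0\<close> divided by \<open>D m * \<dots> * D (K - 1)\<close>
  (lemma \<open>fps_conv_radius_term_fps_remainder\<close>).

  It remains to understand \<open>D K\<close>. The polynomial \<open>1 - 4 * P K\<close> vanishes at \<open>\<rho>\<close> to first order
  and, because the exponents have no common divisor, nowhere else in the closed disc of radius \<open>\<rho>\<close>.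
  So \<open>D K = sqrt (1 - z / \<rho>) * H\<close> with \<open>H\<close> analytic beyond \<open>\<rho>\<close>
  (lemma \<open>disc_fps_singular_factor\<close>).
  The coefficients of \<open>sqrt (1 - z / \<rho>)\<close> are binomial coefficients of known asymptotics, and
  multiplication by a series analytic beyond \<open>\<rho>\<close> multiplies the leading term by the value of that
  series at \<open>\<rho>\<close> (lemma \<open>coeff_limit_mult\<close>, by dominated convergence).
\<close>

section \<open>Sizes of open terms\<close>

lemma m_open_iff: "m_open m M \<longleftrightarrow> \<not> has_free m M"
proof -
  have "has_free l ((Lam ^^ m) M) \<longleftrightarrow> has_free (l + m) M" for l
    by (induction m arbitrary: l) auto
  then show ?thesis
    by (simp add: m_open_def closed_term_def)
qed

text \<open>
  A binary tree has one application less than it has indices; the surplus \<open>d\<close> on the left lets every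
  index carry the cost of one application.
\<close>

lemma term_size_eq:
  "term_size a b c d M + d = term_size (a + d) b 0 0 M + c * abstractions M"
  by (induction M) (auto simp: algebra_simps)

text \<open>
  Here \<open>x\<close> is the total number of successors and \<open>y\<close> the number of applications. The inequality
  says that the \<open>y + 1\<close> indices are at most \<open>l + abstractions M - 1\<close> on average; it is
  written without subtraction, and as \<open>y + 1 > 0\<close> it also forces \<open>l + abstractions M > 0\<close>.
\<close>

lemma index_sum_bound:
  assumes "\<not> has_free l M"
  shows "\<exists>x y. term_size a b 0 0 M = (y + 1) * a + x * b \<and>
    x + (y + 1) \<le> (l + abstractions M) * (y + 1)"
  using assms
proof (induction M arbitrary: l)
  case (Ind k)
  then show ?case
    by (intro exI[of _ k] exI[of _ 0]) auto
next
  case (Lam M)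
  then show ?case
    using Lam.IH[of "Suc l"] by simp
next
  case (App M N)
  obtain x y x' y' where
    M: "term_size a b 0 0 M = (y + 1) * a + x * b" 
       "x + (y + 1) \<le> (l + abstractions M) * (y + 1)" and
    N: "term_size a b 0 0 N = (y' + 1) * a + x' * b" 
       "x' + (y' + 1) \<le> (l + abstractions N) * (y' + 1)"
    using App by fastforce
  have "(l + abstractions M) * (y + 1) \<le> (l + abstractions (App M N)) * (y + 1)"
    and "(l + abstractions N) * (y' + 1) \<le> (l + abstractions (App M N)) * (y' + 1)"
    by (intro mult_right_mono; simp)+
  with M N have "(x + x') + ((y + y' + 1) + 1) \<le> (l + abstractions (App M N)) * ((y + y' + 1) + 1)"
    by (simp add: algebra_simps)
  with M N show ?case
    by (intro exI[of _ "x + x'"] exI[of _ "y + y' + 1"]) (simp add: algebra_simps)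
qed

lemma expressible_term_size:
  assumes "m_open m M" "abstractions M = q"
  shows "0 < m + q \<and> expressible a b c d m q (term_size a b c d M)"
proof -
  have free: "\<not> has_free m M"
    using assms by (simp add: m_open_iff)
  obtain x y where xy: "term_size (a + d) b 0 0 M = (y + 1) * (a + d) + x * b"
    "x + (y + 1) \<le> (m + q) * (y + 1)"
    using index_sum_bound[OF free, of "a + d" b] assms by blast
  have "term_size a b c d M = (y + 1) * a + x * b + q * c + y * d"
    using term_size_eq[of a b c d M] xy(1) assms(2) by (simp add: algebra_simps)
  moreover have "int x \<le> (int m - 1 + int q) * (int y + 1)"
  proof -
    have "int (x + (y + 1)) \<le> int ((m + q) * (y + 1))"
      using xy(2) by (rule iffD2[OF of_nat_le_iff])
    then show ?thesis
      by (simp add: algebra_simps)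
  qed
  moreover have "0 < m + q"
    using xy(2) by (cases "m + q") auto
  ultimately show ?thesis
    unfolding expressible_def by blast
qed

section \<open>Counting terms by index weights\<close>

text \<open>
  The parameters \<open>a\<close> and \<open>b\<close> are the costs of an index \<open>0\<close> and of a successor; abstractions and
  applications are free.
\<close>

definition terms :: "nat \<Rightarrow> nat \<Rightarrow> nat \<Rightarrow> nat \<Rightarrow> nat \<Rightarrow> lterm set" where
  "terms a b m q n = {M. \<not> has_free m M \<and> abstractions M = q \<and> term_size a b 0 0 M = n}"

lemma L_eq_card_terms:
  assumes "n + d = t + c * q"
  shows "L a b c d m q n = card (terms (a + d) b m q t)"
proof -
  have "term_size a b c d M = n \<longleftrightarrow> term_size (a + d) b 0 0 M = t" if "abstractions M = q" for M
    using term_size_eq[of a b c d M] that assms by auto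
  then show ?thesis
    unfolding L_def terms_def m_open_iff by (intro arg_cong[of _ _ card]) auto
qed

text \<open>
  Only the indices below \<open>m + abstractions M\<close> can occur, so the weights have to be proportional just
  for these. This matters when only the index \<open>0\<close> can occur: then \<open>p\<close> need not divide \<open>b\<close>.
\<close>

lemma term_size_scale:
  assumes "\<And>j. j < m + abstractions M \<Longrightarrow> a + b * j = p * (a' + b' * j)" "\<not> has_free m M"
  shows "term_size a b 0 0 M = p * term_size a' b' 0 0 M"
  using assms
proof (induction M arbitrary: m)
  case (Ind k)
  then show ?case
    using Ind(1)[of k] by (simp add: mult.commute[of k])
next
  case (Lam M)
  then show ?case
    using Lam.IH[of "Suc m"] by simp
next
  case (App M N)
  then show ?case
    using App.IH[of m] by (simp add: algebra_simps)
qed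

lemma terms_scale:
  assumes "\<And>j. j < m + q \<Longrightarrow> a + b * j = p * (a' + b' * j)" "0 < p"
  shows "terms a b m q (p * t) = terms a' b' m q t"
  using term_size_scale[of m _ a b p a' b'] assms unfolding terms_def by auto

lemma terms_rec:
  "terms a b m q n =
     (if q = 0 then Ind ` {j. j < m \<and> a + b * j = n} else Lam ` terms a b (Suc m) (q - 1) n) \<union>
     (\<lambda>(li, M, N). App M N) `
       (SIGMA (l, i) : {..q} \<times> {..n}. terms a b m l i \<times> terms a b m (q - l) (n - i))"
  (is "_ = ?A \<union> ?B")
proof (intro set_eqI iffI)
  fix M assume M: "M \<in> terms a b m q n"
  show "M \<in> ?A \<union> ?B"
  proof (cases M)
    case (Ind k)
    with M show ?thesis by (auto simp: terms_def mult.commute)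
  next
    case (Lam M)
    with M show ?thesis by (auto simp: terms_def)
  next
    case (App M1 M2)
    with M have "((abstractions M1, term_size a b 0 0 M1), M1, M2) \<in>
      (SIGMA (l, i) : {..q} \<times> {..n}. terms a b m l i \<times> terms a b m (q - l) (n - i))"
      by (auto simp: terms_def)
    then show ?thesis unfolding App by force
  qed
next
  fix M assume "M \<in> ?A \<union> ?B"
  then show "M \<in> terms a b m q n"
  proof
    assume "M \<in> ?A"
    then show ?thesis
      by (cases "q = 0") (auto simp: terms_def mult.commute)
  next
    assume "M \<in> ?B"
    then show ?thesis
      by (auto simp: terms_def)
  qed
qed

text \<open>
  Since every term has positive size, both parts of an application are smaller than the whole; this
  makes the recursion above well-founded although abstractions are free.
\<close>

lemma terms_size_0:
  assumes "1 \<le> a"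
  shows "terms a b m q 0 = {}"
proof -
  have "term_size a b 0 0 M > 0" for M
    by (induction M) (use assms in auto)
  then show ?thesis
    by (auto simp: terms_def dest: less_not_refl2)
qed

lemma finite_terms:
  assumes "1 \<le> a"
  shows "finite (terms a b m q n)"
proof (induction "q + n" arbitrary: q n m rule: less_induct)
  case less
  have "finite (terms a b m l i \<times> terms a b m (q - l) (n - i))" if "l \<le> q" "i \<le> n" for l i
  proof (cases "i = 0 \<or> i = n")
    case True
    then show ?thesis
      using terms_size_0[OF assms] by auto
  next
    case False
    with that show ?thesis
      using less[of l i m] less[of "q - l" "n - i" m] by auto
  qed
  moreover have "finite (terms a b (Suc m) (q - 1) n)" if "q \<noteq> 0"
    using that less[of "q - 1" n "Suc m"] by auto
  ultimately show ?case
    unfolding terms_rec[of a b m q n] by (intro finite_UnI finite_imageI) auto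
qed

lemma card_terms_rec:
  assumes "1 \<le> a"
  shows "card (terms a b m q n) =
    (if q = 0 then card {j. j < m \<and> a + b * j = n} else card (terms a b (Suc m) (q - 1) n)) +
    (\<Sum>l\<le>q. \<Sum>i\<le>n. card (terms a b m l i) * card (terms a b m (q - l) (n - i)))"
proof -
  let ?A = "if q = 0 then Ind ` {j. j < m \<and> a + b * j = n} else Lam ` terms a b (Suc m) (q - 1) n"
  let ?S = "SIGMA (l, i) : {..q} \<times> {..n}. terms a b m l i \<times> terms a b m (q - l) (n - i)"
  let ?f = "\<lambda>(li :: nat \<times> nat, M, N). App M N"
  have fin: "finite ?A" "finite ?S"
    using finite_terms[OF assms] by (auto intro!: finite_SigmaI)
  have inj: "inj_on ?f ?S"
    by (auto simp: inj_on_def terms_def)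
  have "card (terms a b m q n) = card ?A + card (?f ` ?S)"
    unfolding terms_rec[of a b m q n] using fin
    by (intro card_Un_disjoint finite_imageI) auto
  also have "card ?A = (if q = 0 then card {j. j < m \<and> a + b * j = n}
      else card (terms a b (Suc m) (q - 1) n))"
    by (auto simp: card_image inj_on_def)
  also have "card (?f ` ?S) = card ?S"
    by (rule card_image[OF inj])
  also have "card ?S = (\<Sum>(l, i)\<in>{..q} \<times> {..n}. card (terms a b m l i \<times> terms a b m (q - l) (n - i)))"
    using finite_terms[OF assms] by (subst card_SigmaI) (auto simp: case_prod_unfold)
  also have "\<dots> = (\<Sum>l\<le>q. \<Sum>i\<le>n. card (terms a b m l i) * card (terms a b m (q - l) (n - i)))"
    by (simp add: sum.cartesian_product card_cartesian_product)
  finally show ?thesis .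
qed

section \<open>Generating functions\<close>

text \<open>
  The generating polynomial of the indices below \<open>k\<close>. It is polymorphic because it is needed for
  real and complex arguments as well as for the formal variable.
\<close>

definition index_poly :: "nat \<Rightarrow> nat \<Rightarrow> nat \<Rightarrow> 'a :: comm_semiring_1 \<Rightarrow> 'a" where
  "index_poly a b k z = (\<Sum>j<k. z ^ (a + b * j))"

definition term_fps :: "nat \<Rightarrow> nat \<Rightarrow> nat \<Rightarrow> nat \<Rightarrow> complex fps" where
  "term_fps a b m q = Abs_fps (\<lambda>n. of_nat (card (terms a b m q n)))"

lemma term_fps_rec:
  assumes "1 \<le> a"
  shows "term_fps a b m q =
    (if q = 0 then index_poly a b m fps_X else term_fps a b (Suc m) (q - 1)) +
    (\<Sum>l\<le>q. term_fps a b m l * term_fps a b m (q - l))"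
proof (rule fps_ext)
  fix n
  have "card {j. j < m \<and> a + b * j = n} = (\<Sum>j<m. if a + b * j = n then 1 else 0)"
    by (simp add: sum.If_cases Int_def)
  then have "of_nat (card {j. j < m \<and> a + b * j = n}) = fps_nth (index_poly a b m fps_X :: complex fps) n"
    by (simp add: index_poly_def fps_sum_nth eq_commute[of n] if_distrib[of of_nat] cong: if_cong)
  then show "fps_nth (term_fps a b m q) n = fps_nth ((if q = 0 then index_poly a b m fps_X
      else term_fps a b (Suc m) (q - 1)) +
    (\<Sum>l\<le>q. term_fps a b m l * term_fps a b m (q - l))) n"
    by (simp add: term_fps_def card_terms_rec[OF assms, of b m q n] fps_sum_nth fps_mult_nth
        atLeast0AtMost)
qed

text \<open>
  The square root of the discriminant of the quadratic equation for \<open>term_fps a b m 0\<close>, with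
  constant coefficient 1.
\<close>

definition disc_fps :: "nat \<Rightarrow> nat \<Rightarrow> nat \<Rightarrow> complex fps" where
  "disc_fps a b m = 1 - 2 * term_fps a b m 0"

lemma disc_fps_nth_0: "1 \<le> a \<Longrightarrow> fps_nth (disc_fps a b m) 0 = 1"
  by (simp add: disc_fps_def term_fps_def terms_size_0)

lemma disc_fps_square:
  assumes "1 \<le> a"
  shows "disc_fps a b m ^ 2 = 1 - 4 * index_poly a b m fps_X"
proof -
  have "term_fps a b m 0 = index_poly a b m fps_X + term_fps a b m 0 ^ 2"
    using term_fps_rec[OF assms, of b m 0] by (simp add: power2_eq_square)
  then have *: "index_poly a b m fps_X = term_fps a b m 0 - term_fps a b m 0 ^ 2"
    by (simp add: algebra_simps)
  show ?thesis
    unfolding disc_fps_def * by (simp add: power2_eq_square algebra_simps)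
qed

text \<open>
  In an application with \<open>q + 1\<close> abstractions in total, the cases where all of them lie in one of the
  two parts contribute \<open>2 * term_fps a b m 0 * term_fps a b m (q + 1)\<close>. Moving this to the left-hand side
  yields the factor \<open>disc_fps a b m\<close>.
\<close>

lemma term_fps_Suc:
  assumes "1 \<le> a"
  shows "term_fps a b m (Suc q) = inverse (disc_fps a b m) *
    (term_fps a b (Suc m) q + (\<Sum>l=1..q. term_fps a b m l * term_fps a b m (Suc q - l)))"
    (is "_ = inverse ?D * ?R")
proof -
  let ?T = "term_fps a b m"
  have "(\<Sum>l\<le>Suc q. ?T l * ?T (Suc q - l)) =
      ?T 0 * ?T (Suc q) + (\<Sum>l=1..q. ?T l * ?T (Suc q - l)) + ?T (Suc q) * ?T 0"
    by (simp add: sum.atLeast_Suc_atMost[of 0 q] atMost_atLeast0)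
  with term_fps_rec[OF assms, of b m "Suc q"] 
  have "?T (Suc q) * ?D = ?R"
    by (simp add: disc_fps_def algebra_simps)
  then have "inverse ?D * ?R = inverse ?D * (?T (Suc q) * ?D)"
    by simp
  also have "\<dots> = (inverse ?D * ?D) * ?T (Suc q)"
    by (simp only: mult_ac)
  finally show ?thesis
    using disc_fps_nth_0[OF assms] by (simp add: inverse_mult_eq_1)
qed

lemma fps_conv_radius_sum_ge:
  fixes f :: "'b \<Rightarrow> complex fps"
  assumes "\<And>x. x \<in> A \<Longrightarrow> r \<le> fps_conv_radius (f x)"
  shows "r \<le> fps_conv_radius (\<Sum>x\<in>A. f x)"
  using assms
proof (induction A rule: infinite_finite_induct)
  case (insert x A)
  then show ?case
    using fps_conv_radius_add[of "f x" "\<Sum>x\<in>A. f x"] by (auto intro: order_trans[rotated])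
qed auto

lemma fps_conv_radius_mult_ge:
  fixes f g :: "complex fps"
  shows "r \<le> fps_conv_radius f \<Longrightarrow> r \<le> fps_conv_radius g \<Longrightarrow> r \<le> fps_conv_radius (f * g)"
  using fps_conv_radius_mult[of f g] by (auto intro: order_trans[rotated])

lemma fps_conv_radius_add_ge:
  fixes f g :: "complex fps"
  shows "r \<le> fps_conv_radius f \<Longrightarrow> r \<le> fps_conv_radius g \<Longrightarrow> r \<le> fps_conv_radius (f + g)"
  using fps_conv_radius_add[of f g] by (auto intro: order_trans[rotated])

lemma fps_conv_radius_diff_ge:
  fixes f g :: "complex fps"
  shows "r \<le> fps_conv_radius f \<Longrightarrow> r \<le> fps_conv_radius g \<Longrightarrow> r \<le> fps_conv_radius (f - g)"
  using fps_conv_radius_diff[of f g] by (auto intro: order_trans[rotated])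

lemma fps_conv_radius_term_fps:
  assumes "1 \<le> a"
    and "\<And>k. k < K \<Longrightarrow> r \<le> fps_conv_radius (disc_fps a b k)"
    and inv: "\<And>k. k < K \<Longrightarrow> r \<le> fps_conv_radius (inverse (disc_fps a b k))"
    and "m + q < K"
  shows "r \<le> fps_conv_radius (term_fps a b m q)"
  using assms(4)
proof (induction q arbitrary: m rule: less_induct)
  case (less q)
  show ?case
  proof (cases q)
    case 0
    have "term_fps a b m 0 = fps_const (1/2) * (1 - disc_fps a b m)"
      by (simp add: disc_fps_def numeral_fps_const flip: mult.assoc)
    then show ?thesis
      using assms(2)[of m] less.prems 0
      by (auto intro!: fps_conv_radius_mult_ge fps_conv_radius_diff_ge)
  next
    case (Suc q')
    then show ?thesis
      unfolding Suc term_fps_Suc[OF assms(1)] using less.prems Suc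
      by (intro fps_conv_radius_mult_ge fps_conv_radius_add_ge fps_conv_radius_sum_ge inv less.IH) auto
  qed
qed

text \<open>
  The abstractions of the dominant terms form a chain that is passed from one \<open>term_fps a b (m + i)\<close> to
  the next. All products on the right-hand side of \<open>term_fps_Suc\<close> split the abstractions nontrivially,
  so by the preceding lemma they belong to the regular part.
\<close>

lemma fps_conv_radius_term_fps_remainder:
  assumes "1 \<le> a"
    and disc: "\<And>k. k < K \<Longrightarrow> r \<le> fps_conv_radius (disc_fps a b k)"
    and inv: "\<And>k. k < K \<Longrightarrow> r \<le> fps_conv_radius (inverse (disc_fps a b k))"
    and "m + q = K"
  shows "r \<le> fps_conv_radius
    (term_fps a b m q - (\<Prod>i<q. inverse (disc_fps a b (m + i))) * term_fps a b K 0)"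
  using assms(4)
proof (induction q arbitrary: m)
  case 0
  then show ?case by simp
next
  case (Suc q)
  let ?P = "\<lambda>m q. (\<Prod>i<q. inverse (disc_fps a b (m + i)))"
  have "term_fps a b m (Suc q) - ?P m (Suc q) * term_fps a b K 0 =
    inverse (disc_fps a b m) * ((term_fps a b (Suc m) q - ?P (Suc m) q * term_fps a b K 0) + 
      (\<Sum>l=1..q. term_fps a b m l * term_fps a b m (Suc q - l)))"
    unfolding term_fps_Suc[OF assms(1)] prod.lessThan_Suc_shift by (simp add: algebra_simps)
  also have "r \<le> fps_conv_radius \<dots>"
    using Suc.prems
    by (intro fps_conv_radius_mult_ge fps_conv_radius_add_ge fps_conv_radius_sum_ge inv
        fps_conv_radius_term_fps[OF assms(1) disc inv] Suc.IH) auto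
  finally show ?case .
qed

section \<open>Transfer of coefficient asymptotics\<close>

text \<open>
  The coefficient of the product is a convolution, in which the summand belonging to a fixed
  coefficient \<open>k\<close> of \<open>B\<close> tends to \<open>fps_nth B k * \<rho> ^ k * c\<close>. Tannery's theorem allows to interchange
  limit and sum. The weight \<open>n * sqrt n\<close> is \<open>n powr (3 / 2)\<close>.
\<close>

lemma coeff_limit_mult:
  fixes B F :: "complex fps" and \<rho> :: real
  assumes "0 < \<rho>"
    and lim: "(\<lambda>n. fps_nth F n * of_real (\<rho> ^ n * (real n * sqrt (real n)))) \<longlonglongrightarrow> c"
    and rad: "ereal \<rho> < fps_conv_radius B"
  shows "(\<lambda>n. fps_nth (B * F) n * of_real (\<rho> ^ n * (real n * sqrt (real n)))) \<longlonglongrightarrow>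
    eval_fps B (of_real \<rho>) * c"
proof -
  define w where "w n = real n * sqrt (real n)" for n
  have w_nonneg: "0 \<le> w n" for n
    by (simp add: w_def)
  define t where "t k n = (if k \<le> n then fps_nth B k * fps_nth F (n - k) * of_real (\<rho> ^ n * w n) else 0)" for k n
  obtain M0 where M0: "\<And>n. norm (fps_nth F n * of_real (\<rho> ^ n * w n)) \<le> M0"
    using convergent_imp_Bseq[OF convergentI[OF lim]] unfolding w_def Bseq_def by blast
  define M where "M = 3 * M0 + norm (fps_nth F 0)"
  have "0 \<le> M0"
    using M0[of 0] norm_ge_zero order_trans by blast
  have F_bound: "norm (fps_nth F n) * \<rho> ^ n * w (Suc n) \<le> M" for n
  proof (cases "n = 0")
    case True
    then show ?thesis
      using \<open>0 \<le> M0\<close> by (simp add: M_def w_def)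
  next
    case False
    have "w (Suc n) \<le> 3 * w n"
    proof -
      have "real (Suc n) * sqrt (real (Suc n)) \<le> (2 * real n) * sqrt (2 * real n)"
        using False by (intro mult_mono real_sqrt_le_mono) auto
      also have "\<dots> = (2 * sqrt 2) * w n"
        by (simp add: w_def real_sqrt_mult)
      also have "\<dots> \<le> 3 * w n"
      proof (intro mult_right_mono w_nonneg)
        have "sqrt 2 \<le> 3 / 2"
          by (rule real_le_lsqrt) (auto simp: power2_eq_square)
        then show "2 * sqrt 2 \<le> 3" by simp
      qed
      finally show ?thesis
        by (simp add: w_def)
    qed
    then have "norm (fps_nth F n) * \<rho> ^ n * w (Suc n) \<le> norm (fps_nth F n) * \<rho> ^ n * (3 * w n)"
      using \<open>0 < \<rho>\<close> by (intro mult_left_mono) auto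
    also have "\<dots> = 3 * norm (fps_nth F n * of_real (\<rho> ^ n * w n))"
      using \<open>0 < \<rho>\<close> w_nonneg[of n] by (simp add: norm_mult norm_power abs_mult)
    also have "\<dots> \<le> M"
      using M0[of n] norm_ge_zero[of "fps_nth F 0"] unfolding M_def by linarith
    finally show ?thesis .
  qed
  \<comment> \<open>The weight is submultiplicative up to a shift, so passing from \<open>i\<close> to \<open>i + k\<close> costs a factor that is
    polynomial in \<open>k\<close>. Rounding it up to \<open>(k + 1) ^ 2\<close> makes it the effect of two derivatives on \<open>B\<close>,
    which do not shrink the radius of convergence.\<close>
  have w_submult: "w (i + k) \<le> w (Suc i) * real (Suc k) ^ 2" for i k
  proof -
    have le: "real (i + k) \<le> real (Suc i) * real (Suc k)"
      by (simp add: algebra_simps)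
    have "w (i + k) \<le> (real (Suc i) * real (Suc k)) * sqrt (real (Suc i) * real (Suc k))"
      unfolding w_def using le by (intro mult_mono real_sqrt_le_mono) auto
    also have "\<dots> = w (Suc i) * (real (Suc k) * sqrt (real (Suc k)))"
      by (simp add: w_def real_sqrt_mult)
    also have "\<dots> \<le> w (Suc i) * (real (Suc k) * real (Suc k))"
      by (intro mult_left_mono w_nonneg real_le_lsqrt) (auto simp: power2_eq_square)
    finally show ?thesis
      by (simp add: power2_eq_square)
  qed
  define B2 where "B2 = fps_deriv (fps_X * fps_deriv (fps_X * B))"
  have B2_nth: "fps_nth B2 k = of_nat (Suc k) ^ 2 * fps_nth B k" for k
  proof -
    have "fps_nth (fps_deriv (fps_X * H)) k = of_nat (Suc k) * fps_nth H k" for H :: "complex fps"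
      unfolding fps_deriv_nth by simp
    then show ?thesis
      by (simp only: B2_def power2_eq_square mult.assoc)
  qed
  have "ereal \<rho> < fps_conv_radius B2"
  proof -
    have "fps_conv_radius B \<le> fps_conv_radius (fps_X * B)"
      by (intro fps_conv_radius_mult_ge) auto
    also have "\<dots> \<le> fps_conv_radius (fps_X * fps_deriv (fps_X * B))"
      by (intro fps_conv_radius_mult_ge fps_conv_radius_deriv) auto
    also have "\<dots> \<le> fps_conv_radius B2"
      unfolding B2_def by (rule fps_conv_radius_deriv)
    finally show ?thesis
      using rad by (rule less_le_trans[rotated])
  qed
  then have "summable (\<lambda>k. norm (fps_nth B2 k * of_real \<rho> ^ k))"
    using \<open>0 < \<rho>\<close> by (intro norm_summable_fps) simp
  then have summable: "summable (\<lambda>k. M * norm (fps_nth B2 k * of_real \<rho> ^ k))"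
    by (rule summable_mult)
  have bound: "norm (t k n) \<le> M * norm (fps_nth B2 k * of_real \<rho> ^ k)" for k n
  proof (cases "k \<le> n")
    case True
    then obtain i where n: "n = i + k"
      using le_Suc_ex by (metis add.commute)
    have "norm (t k n) = (norm (fps_nth F i) * \<rho> ^ i) * (norm (fps_nth B k) * \<rho> ^ k) * w (i + k)"
      using \<open>0 < \<rho>\<close> w_nonneg[of n] by (simp add: t_def n norm_mult norm_power abs_mult power_add)
    also have "\<dots> \<le> (norm (fps_nth F i) * \<rho> ^ i) * (norm (fps_nth B k) * \<rho> ^ k) * 
        (w (Suc i) * real (Suc k) ^ 2)"
      using \<open>0 < \<rho>\<close> by (intro mult_left_mono w_submult) auto
    also have "\<dots> = (norm (fps_nth F i) * \<rho> ^ i * w (Suc i)) * norm (fps_nth B2 k * of_real \<rho> ^ k)"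
      using \<open>0 < \<rho>\<close> by (simp add: B2_nth norm_mult norm_power del: of_nat_Suc)
    also have "\<dots> \<le> M * norm (fps_nth B2 k * of_real \<rho> ^ k)"
      by (intro mult_right_mono F_bound) auto
    finally show ?thesis .
  next
    case False
    have "0 \<le> M"
      using \<open>0 \<le> M0\<close> by (simp add: M_def)
    with False show ?thesis
      by (simp add: t_def)
  qed
  have term_lim: "(\<lambda>n. t k n) \<longlonglongrightarrow> fps_nth B k * of_real \<rho> ^ k * c" for k
  proof (rule LIMSEQ_offset[where k = k])
    have "(\<lambda>n. fps_nth B k * of_real \<rho> ^ k * (fps_nth F n * of_real (\<rho> ^ n * w n)) * of_real (w (n + k) / w n))
      \<longlonglongrightarrow> fps_nth B k * of_real \<rho> ^ k * c * of_real 1"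
    proof (intro tendsto_intros)
      show "(\<lambda>n. fps_nth F n * of_real (\<rho> ^ n * w n)) \<longlonglongrightarrow> c"
        using lim by (simp add: w_def)
      show "(\<lambda>n. w (n + k) / w n) \<longlonglongrightarrow> 1"
        unfolding w_def by real_asymp
    qed
    then show "(\<lambda>n. t k (n + k)) \<longlonglongrightarrow> fps_nth B k * of_real \<rho> ^ k * c"
      unfolding of_real_1 mult_1_right
    proof (rule Lim_transform_eventually)
      show "\<forall>\<^sub>F n in sequentially. fps_nth B k * of_real \<rho> ^ k * 
          (fps_nth F n * of_real (\<rho> ^ n * w n)) * of_real (w (n + k) / w n) = t k (n + k)"
        using eventually_gt_at_top[of 0]
        by eventually_elim (simp add: t_def w_def power_add)
    qed
  qed
  have "(\<lambda>n. \<Sum>k. t k n) \<longlonglongrightarrow> (\<Sum>k. fps_nth B k * of_real \<rho> ^ k * c)"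
    using tannerys_theorem[OF term_lim _ summable] bound by (simp add: case_prod_unfold)
  also have "(\<lambda>n. \<Sum>k. t k n) = (\<lambda>n. fps_nth (B * F) n * of_real (\<rho> ^ n * w n))"
  proof
    fix n
    have "(\<Sum>k. t k n) = (\<Sum>k\<le>n. t k n)"
      by (rule suminf_finite) (auto simp: t_def)
    then show "(\<Sum>k. t k n) = fps_nth (B * F) n * of_real (\<rho> ^ n * w n)"
      by (simp add: t_def fps_mult_nth atLeast0AtMost sum_distrib_right)
  qed
  also have "(\<Sum>k. fps_nth B k * of_real \<rho> ^ k * c) = eval_fps B (of_real \<rho>) * c"
    unfolding eval_fps_def using rad \<open>0 < \<rho>\<close>
    by (intro suminf_mult2[symmetric] summable_fps) simp
  finally show ?thesis
    by (simp add: w_def)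
qed

text \<open>
  The factor \<open>1\<close> of \<open>B = B * 1\<close> has weighted coefficients tending to 0.
\<close>

lemma coeff_limit_0:
  fixes B :: "complex fps"
  assumes "0 < \<rho>" "ereal \<rho> < fps_conv_radius B"
  shows "(\<lambda>n. fps_nth B n * of_real (\<rho> ^ n * (real n * sqrt (real n)))) \<longlonglongrightarrow> 0"
proof -
  have "(\<lambda>n. fps_nth (1 :: complex fps) n * of_real (\<rho> ^ n * (real n * sqrt (real n)))) \<longlonglongrightarrow> 0"
    by (rule tendsto_eventually, rule eventually_mono[OF eventually_gt_at_top[of 0]]) simp
  from coeff_limit_mult[OF assms(1) this assms(2)] show ?thesis
    by simp
qed

text \<open>
  The expansion of \<open>sqrt (1 - z / \<rho>)\<close>.
\<close>

definition sqrt_fps :: "real \<Rightarrow> complex fps" where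
  "sqrt_fps \<rho> = fps_compose (fps_binomial (1 / 2)) (fps_const (- 1 / of_real \<rho>) * fps_X)"

lemma sqrt_fps_square: "sqrt_fps \<rho> ^ 2 = 1 - fps_const (1 / of_real \<rho>) * fps_X"
proof -
  have "sqrt_fps \<rho> ^ 2 = fps_compose (fps_binomial (1 / 2) ^ 2) (fps_const (- 1 / of_real \<rho>) * fps_X)"
    by (simp add: sqrt_fps_def fps_compose_power)
  also have "fps_binomial (1 / 2 :: complex) ^ 2 = 1 + fps_X"
    using fps_binomial_add_mult[of "1 / 2 :: complex" "1 / 2"] fps_binomial_of_nat[of 1, where 'a = complex]
    by (simp add: power2_eq_square)
  finally show ?thesis
    by (simp add: fps_compose_add_distrib fps_const_neg[symmetric] del: fps_const_neg)
qed

lemma Gamma_minus_half: "Gamma (- 1 / 2 :: real) = - 2 * sqrt pi"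
proof -
  have "Gamma (- 1 / 2 + 1 :: real) = (- 1 / 2) * Gamma (- 1 / 2)"
  proof (rule Gamma_plus1, rule notI)
    assume "(- 1 / 2 :: real) \<in> \<int>\<^sub>\<le>\<^sub>0"
    then obtain n :: int where "- 1 / 2 = real_of_int n"
      by (auto elim!: nonpos_Ints_cases)
    then have "real_of_int (2 * n) = real_of_int (- 1)"
      by simp
    then show False
      unfolding of_int_eq_iff by presburger
  qed
  then show ?thesis
    by (simp add: Gamma_one_half_real)
qed

lemma coeff_limit_sqrt_fps:
  assumes "0 < \<rho>"
  shows "(\<lambda>n. fps_nth (sqrt_fps \<rho>) n * of_real (\<rho> ^ n * (real n * sqrt (real n)))) \<longlonglongrightarrow>
    of_real (- 1 / (2 * sqrt pi))"
proof -
  have "(\<lambda>n. (1 / 2 gchoose n) / ((- 1) ^ n / exp ((1 / 2 + 1) * ln (real n)))) \<longlonglongrightarrow> inverse (Gamma (- (1 / 2 :: real)))"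
    using gbinomial_asymptotic[of "1 / 2 :: real"] by simp
  also have "inverse (Gamma (- (1 / 2 :: real))) = - 1 / (2 * sqrt pi)"
    using Gamma_minus_half by (simp add: field_simps)
  finally have "(\<lambda>n. complex_of_real ((1 / 2 gchoose n) / ((- 1) ^ n / exp ((1 / 2 + 1) * ln (real n)))))
      \<longlonglongrightarrow> of_real (- 1 / (2 * sqrt pi))"
    by (rule tendsto_of_real)
  then show ?thesis
  proof (rule Lim_transform_eventually)
    show "\<forall>\<^sub>F n in sequentially. 
      complex_of_real ((1 / 2 gchoose n) / ((- 1) ^ n / exp ((1 / 2 + 1) * ln (real n)))) =
      fps_nth (sqrt_fps \<rho>) n * of_real (\<rho> ^ n * (real n * sqrt (real n)))"
      using eventually_gt_at_top[of 0]
    proof eventually_elim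
      case (elim n)
      have "exp ((1 / 2 + 1) * ln (real n)) = exp (ln (real n)) * exp (1 / 2 * ln (real n))"
        by (simp flip: exp_add)
      also have "\<dots> = real n * sqrt (real n)"
        using elim by (simp add: powr_half_sqrt[symmetric] powr_def)
      finally have "exp ((1 / 2 + 1) * ln (real n)) = real n * sqrt (real n)" .
      moreover have "complex_of_real (1 / 2 gchoose n) = (1 / 2 gchoose n)"
        by (simp add: gbinomial_prod_rev)
      moreover have "fps_nth (sqrt_fps \<rho>) n = (- 1) ^ n * (1 / 2 gchoose n) / of_real \<rho> ^ n"
        by (simp add: sqrt_fps_def power_divide power_minus[of "1 / _"])
      ultimately show ?case
        using \<open>0 < \<rho>\<close> by (cases "even n") simp_all
    qed
  qed
qed

lemma fps_square_eq_iff: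
  fixes F G :: "complex fps"
  assumes "F ^ 2 = G ^ 2" "fps_nth F 0 = fps_nth G 0" "fps_nth F 0 \<noteq> 0"
  shows "F = G"
proof -
  have "F = G \<or> F = - G"
    using assms(1) by (simp add: power2_eq_iff)
  then show ?thesis
    using assms(2,3) by auto
qed

text \<open>
  Formal square roots with a given nonzero constant coefficient are unique. This identifies the
  combinatorially defined series with expansions of analytic square roots, so that no
  information about the convergence of the former is needed beforehand.
\<close>

lemma has_fps_expansion_square_root:
  fixes F G :: "complex fps"
  assumes "f holomorphic_on ball 0 r" "0 < r"
    and "\<And>z. z \<in> ball 0 r \<Longrightarrow> f z ^ 2 = g z"
    and "g has_fps_expansion G" "F ^ 2 = G" "f 0 = fps_nth F 0" "fps_nth F 0 \<noteq> 0"
  shows "f has_fps_expansion F"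
proof -
  define F' where "F' = fps_expansion f 0"
  have F': "f has_fps_expansion F'"
    unfolding F'_def using assms(1,2) by (intro has_fps_expansion_fps_expansion[of "ball 0 r"]) auto
  have "(\<lambda>z. f z ^ 2) has_fps_expansion F' ^ 2"
    by (intro fps_expansion_intros F')
  moreover have "\<forall>\<^sub>F z in nhds 0. f z ^ 2 = g z"
    using assms(2,3) by (intro eventually_nhds_in_open[THEN eventually_mono, of "ball 0 r"]) auto
  then have "(\<lambda>z. f z ^ 2) has_fps_expansion F ^ 2"
    using assms(4,5) by (subst has_fps_expansion_cong) auto
  ultimately have "F' ^ 2 = F ^ 2"
    by (rule fps_expansion_unique_complex)
  moreover have "fps_nth F' 0 = f 0"
    using has_fps_expansion_imp_0_eq_fps_nth_0[OF F'] by simp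
  ultimately have "F' = F"
    using assms(6,7) by (metis fps_square_eq_iff)
  with F' show ?thesis
    by (rule subst[of F' F, rotated])
qed

section \<open>The dominant singularity\<close>

lemma radicand_eq: "radicand a b d k z = 1 - 4 * index_poly (a + d) b k z"
  by (simp add: radicand_def index_poly_def power_add sum_distrib_left mult.assoc)

lemma index_poly_0: "1 \<le> a \<Longrightarrow> index_poly a b k 0 = 0"
  unfolding index_poly_def by (intro sum.neutral) (auto simp: power_0_left)

lemma index_poly_mono_index:
  fixes x :: real
  shows "0 \<le> x \<Longrightarrow> k \<le> l \<Longrightarrow> index_poly a b k x \<le> index_poly a b l x"
  unfolding index_poly_def by (intro sum_mono2) auto

lemma index_poly_strict_mono:
  fixes x y :: real
  assumes "1 \<le> a" "1 \<le> k" "0 \<le> x" "x < y"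
  shows "index_poly a b k x < index_poly a b k y"
  unfolding index_poly_def using assms
  by (intro sum_strict_mono power_strict_mono) (auto simp: lessThan_empty_iff)

lemma continuous_index_poly: "continuous_on A (index_poly a b k :: real \<Rightarrow> real)"
  unfolding index_poly_def[abs_def] by (intro continuous_intros)

lemma xi_eqI:
  assumes "1 \<le> a + d" "1 \<le> k" "0 < z" "index_poly (a + d) b k z = 1 / 4"
  shows "\<xi> a b d k = z"
  unfolding \<xi>_def
proof (rule Least_equality)
  show "0 < z \<and> radicand a b d k z = 0"
    using assms by (simp add: radicand_eq)
  show "z \<le> y" if "0 < y \<and> radicand a b d k y = 0" for y
    using index_poly_strict_mono[of "a + d" k y z b] assms that
    by (force simp: radicand_eq not_le[symmetric])
qed

lemma xi_root:
  assumes "1 \<le> a + d" "1 \<le> k"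
  shows "0 < \<xi> a b d k" "index_poly (a + d) b k (\<xi> a b d k) = 1 / 4"
proof -
  let ?P = "index_poly (a + d) b k :: real \<Rightarrow> real"
  have P0: "?P 0 = 0"
    using assms by (simp add: index_poly_0)
  have P1: "?P 1 \<ge> 1 / 4"
    using assms by (simp add: index_poly_def)
  obtain z where z: "0 \<le> z" "?P z = 1 / 4"
    using IVT'[of ?P 0 "1 / 4" 1] P0 P1 continuous_index_poly by auto
  have "0 < z"
    using z P0 by (cases "z = 0") auto
  with xi_eqI[OF assms this z(2)] z show "0 < \<xi> a b d k" "?P (\<xi> a b d k) = 1 / 4"
    by simp_all
qed

lemma has_fps_expansion_index_poly:
  "(\<lambda>z :: complex. 1 - 4 * index_poly a b k z) has_fps_expansion 1 - 4 * index_poly a b k fps_X"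
  unfolding index_poly_def by (intro fps_expansion_intros)

text \<open>
  In the disc the values of \<open>4 * index_poly a b k\<close> have modulus less than 1, so the radicand stays in the right half
  plane, where the principal square root is holomorphic and has no zeros.
\<close>

lemma disc_fps_analytic:
  assumes "1 \<le> a" "0 < r" "4 * index_poly a b k r < 1"
  defines "f \<equiv> \<lambda>z. csqrt (1 - 4 * index_poly a b k z)"
  shows "f has_fps_expansion disc_fps a b k" "f holomorphic_on ball 0 r"
    and "\<And>z. z \<in> ball 0 r \<Longrightarrow> f z \<noteq> 0"
proof -
  have Re_pos: "0 < Re (1 - 4 * index_poly a b k z)" if "z \<in> ball 0 r" for z :: complex
  proof -
    have "norm (index_poly a b k z) \<le> (\<Sum>j<k. norm (z ^ (a + b * j)))"
      unfolding index_poly_def by (rule norm_sum)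
    also have "\<dots> \<le> index_poly a b k r"
      unfolding index_poly_def using that
      by (intro sum_mono) (auto simp: norm_power intro!: power_mono)
    finally have "Re (index_poly a b k z) \<le> index_poly a b k r"
      using complex_Re_le_cmod order_trans by blast
    then show ?thesis
      using assms(3) by simp
  qed
  show holo: "f holomorphic_on ball 0 r"
    unfolding f_def
  proof (rule holomorphic_on_csqrt')
    show "(\<lambda>z. 1 - 4 * index_poly a b k z) holomorphic_on ball 0 r"
      unfolding index_poly_def by (intro holomorphic_intros)
    show "1 - 4 * index_poly a b k z \<notin> \<real>\<^sub>\<le>\<^sub>0" if "z \<in> ball 0 r" for z :: complex
      using Re_pos[OF that] complex_nonpos_Reals_iff by force
  qed
  show "f z \<noteq> 0" if "z \<in> ball 0 r" for z
  proof -
    have "1 - 4 * index_poly a b k z \<noteq> 0"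
      using Re_pos[OF that] by (metis less_irrefl zero_complex.sel(1))
    then show ?thesis
      by (simp add: f_def)
  qed
  have "f 0 = 1"
    using assms(1) by (simp add: f_def index_poly_0)
  then show "f has_fps_expansion disc_fps a b k"
    using disc_fps_nth_0[OF assms(1), of b k]
    by (intro has_fps_expansion_square_root[OF holo assms(2) _ has_fps_expansion_index_poly
          disc_fps_square[OF assms(1)]]) (auto simp: f_def)
qed

lemma power_Gcd_eq_1:
  fixes w :: "'a :: idom"
  assumes "finite A" "\<And>n. n \<in> A \<Longrightarrow> w ^ n = 1"
  shows "w ^ (Gcd A :: nat) = 1"
  using assms
proof (induction A)
  case (insert n A)
  have gcd: "w ^ gcd x y = 1" if x: "w ^ x = 1" and y: "w ^ y = 1" for x y :: nat
  proof (cases "x = 0")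
    case False
    then obtain u v where "x * u = y * v + gcd x y"
      using bezout_nat by blast
    then have "(w ^ x) ^ u = (w ^ y) ^ v * w ^ gcd x y"
      by (simp flip: power_mult power_add)
    then show ?thesis
      using x y by simp
  qed (use y in simp)
  show ?case
    using insert by (auto intro!: gcd)
qed simp

text \<open>
  With \<open>u j = 4 * \<rho> ^ (a + b * j)\<close> and \<open>c = 1 / \<rho>\<close> this divides \<open>1 - 4 * index_poly a b K\<close> by the linear factor
  belonging to its root \<open>\<rho>\<close>. The cofactor is explicit, and for \<open>a > 0\<close> its value at
  \<open>\<rho>\<close> is visibly positive, so the root is simple. The lemma is used both for complex numbers and for formal power series.
\<close>

lemma index_poly_cofactor:
  fixes x :: "'a :: comm_ring_1"
  assumes "\<And>j. j < K \<Longrightarrow> u j * c ^ (a + b * j) = 4" "(\<Sum>j<K. u j) = 1"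
  shows "(1 - c * x) * (\<Sum>j<K. u j * (\<Sum>i<a + b * j. (c * x) ^ i)) = 1 - 4 * index_poly a b K x"
proof -
  have "(1 - c * x) * (\<Sum>j<K. u j * (\<Sum>i<a + b * j. (c * x) ^ i)) =
      (\<Sum>j<K. u j * ((1 - c * x) * (\<Sum>i<a + b * j. (c * x) ^ i)))"
    by (simp add: sum_distrib_left mult_ac)
  also have "\<dots> = (\<Sum>j<K. u j * (1 - (c * x) ^ (a + b * j)))"
    by (simp add: one_diff_power_eq)
  also have "\<dots> = (\<Sum>j<K. u j - (u j * c ^ (a + b * j)) * x ^ (a + b * j))"
    by (simp add: algebra_simps)
  also have "\<dots> = 1 - 4 * index_poly a b K x"
    using assms by (simp add: sum_subtractf index_poly_def sum_distrib_left)
  finally show ?thesis .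
qed

text \<open>
  Equality in the triangle inequality: each monomial at \<open>z\<close> is bounded in modulus by its value at \<open>\<rho>\<close>, and
  the sums agree, so \<open>(z / \<rho>) ^ n = 1\<close> for each of the exponents \<open>n\<close>, hence also for their greatest
  common divisor.
\<close>

lemma index_poly_eq_quarter_unique:
  fixes z :: complex
  assumes "period a b 0 K = 1" "0 < \<rho>" "index_poly a b K \<rho> = 1 / 4"
    and "norm z \<le> \<rho>" "index_poly a b K z = 1 / 4"
  shows "z = of_real \<rho>"
proof -
  define w where "w = z / of_real \<rho>"
  have z: "z = of_real \<rho> * w"
    using assms(2) by (simp add: w_def)
  have "norm w \<le> 1"
    using assms(2,4) by (simp add: w_def norm_divide)
  then have norm_le: "norm (w ^ n) \<le> 1" for n
    by (simp add: norm_power power_le_one)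
  then have Re_le: "Re (w ^ n) \<le> 1" for n
    using complex_Re_le_cmod order_trans by blast
  have "(\<Sum>j<K. \<rho> ^ (a + b * j) * (1 - Re (w ^ (a + b * j)))) =
    index_poly a b K \<rho> - Re (index_poly a b K z)"
    unfolding index_poly_def z
    by (simp add: power_mult_distrib right_diff_distrib sum_subtractf flip: of_real_power)
  also have "\<dots> = 0"
    unfolding assms(3,5) by simp
  finally have "\<rho> ^ (a + b * j) * (1 - Re (w ^ (a + b * j))) = 0" if "j < K" for j
    using that assms(2) Re_le by (subst (asm) sum_nonneg_eq_0_iff) auto
  then have Re_eq: "Re (w ^ (a + b * j)) = 1" if "j < K" for j
    using that assms(2) by fastforce
  have "w ^ (a + b * j) = 1" if "j < K" for j
  proof -
    have "Re (w ^ (a + b * j)) ^ 2 + Im (w ^ (a + b * j)) ^ 2 \<le> 1"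
      using norm_le[of "a + b * j"] by (simp add: cmod_def)
    then show ?thesis
      using Re_eq[OF that] by (simp add: complex_eq_iff)
  qed
  then have "w ^ period a b 0 K = 1"
    unfolding period_def by (intro power_Gcd_eq_1) auto
  then show ?thesis
    using assms(1) by (simp add: z)
qed

text \<open>
  The zero-free cofactor of \<open>1 - z / \<rho>\<close> has a holomorphic square root \<open>h\<close> in a disc of radius larger
  than \<open>\<rho>\<close>. The sign of \<open>h\<close> is fixed by \<open>h 0 = 1\<close>; the sign of \<open>h \<rho>\<close> is left open here.
\<close>

lemma disc_fps_singular_factor:
  assumes "1 \<le> a" "1 \<le> K" "period a b 0 K = 1" "0 < \<rho>" "index_poly a b K \<rho> = 1 / 4"
  obtains r h H where "\<rho> < r" "h holomorphic_on ball 0 r" "h has_fps_expansion H"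
    and "disc_fps a b K = sqrt_fps \<rho> * H"
    and "h (of_real \<rho>) ^ 2 = of_real (4 * (\<Sum>j<K. real (a + b * j) * \<rho> ^ (a + b * j)))"
proof -
  define Cf where "Cf j = 4 * complex_of_real \<rho> ^ (a + b * j)" for j
  define T where "T z = (\<Sum>j<K. Cf j * (\<Sum>i<a + b * j. (1 / of_real \<rho> * z) ^ i))" for z
  define TF where "TF = (\<Sum>j<K. fps_const (Cf j) * (\<Sum>i<a + b * j. (fps_const (1 / of_real \<rho>) * fps_X) ^ i))"
  have Cf: "Cf j * (1 / of_real \<rho>) ^ (a + b * j) = 4" for j
    using assms(4) by (simp add: Cf_def power_divide)
  have "complex_of_real (4 * index_poly a b K \<rho>) = 1"
    unfolding assms(5) by simp
  then have Cf_sum: "(\<Sum>j<K. Cf j) = 1"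
    by (simp add: Cf_def index_poly_def sum_distrib_left)
  have T: "(1 - 1 / of_real \<rho> * z) * T z = 1 - 4 * index_poly a b K z" for z
    unfolding T_def by (rule index_poly_cofactor[OF Cf Cf_sum])
  have TF: "(1 - fps_const (1 / of_real \<rho>) * fps_X) * TF = 1 - 4 * index_poly a b K fps_X"
    unfolding TF_def
  proof (rule index_poly_cofactor)
    show "fps_const (Cf j) * fps_const (1 / of_real \<rho>) ^ (a + b * j) = 4" for j
      using Cf by (simp add: numeral_fps_const)
    show "(\<Sum>j<K. fps_const (Cf j)) = 1"
      using Cf_sum by (intro fps_ext) (simp add: fps_sum_nth)
  qed
  have T_rho: "T (of_real \<rho>) = of_real (4 * (\<Sum>j<K. real (a + b * j) * \<rho> ^ (a + b * j)))"
    using assms(4) by (simp add: T_def Cf_def sum_distrib_left mult_ac)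
  have T_nonzero: "T z \<noteq> 0" if "norm z \<le> \<rho>" for z
  proof (cases "z = of_real \<rho>")
    case True
    have "0 < (\<Sum>j<K. real (a + b * j) * \<rho> ^ (a + b * j))"
      using assms by (intro sum_pos mult_pos_pos zero_less_power) 
        (auto simp: lessThan_empty_iff intro: add_pos_nonneg)
    then show ?thesis
      unfolding True T_rho of_real_eq_0_iff by linarith
  next
    case False
    then have "index_poly a b K z \<noteq> 1 / 4"
      using index_poly_eq_quarter_unique[OF assms(3-5) that] by blast
    then show ?thesis
      using T[of z] by (auto simp: mult.commute[of 4])
  qed
  have T_holo: "T holomorphic_on A" for A
    unfolding T_def by (intro holomorphic_intros)
  have "continuous_on UNIV T"
    by (rule holomorphic_on_imp_continuous_on[OF T_holo])
  then have T_open: "open {z. T z \<noteq> 0}"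
    by (intro open_Collect_neq continuous_on_const)
  have "cball 0 \<rho> \<subseteq> {z. T z \<noteq> 0}"
    using T_nonzero by auto
  then obtain \<epsilon> where \<epsilon>: "0 < \<epsilon>" "(\<Union>z\<in>cball 0 \<rho>. ball z \<epsilon>) \<subseteq> {z. T z \<noteq> 0}"
    using compact_subset_open_imp_ball_epsilon_subset[OF compact_cball T_open] by blast
  \<comment> \<open>Push a point of the larger disc radially to the boundary of the smaller one.\<close>
  have T_nonzero': "T z \<noteq> 0" if "z \<in> ball 0 (\<rho> + \<epsilon>)" for z
  proof (cases "norm z \<le> \<rho>")
    case False
    have "z \<noteq> 0"
      using False assms(4) by auto
    have "dist (of_real (\<rho> / norm z) * z) z = norm z - \<rho>"
    proof -
      have "of_real (\<rho> / norm z) * z - z = of_real (\<rho> / norm z - 1) * z"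
        by (simp add: algebra_simps)
      then have "dist (of_real (\<rho> / norm z) * z) z = \<bar>\<rho> / norm z - 1\<bar> * norm z"
        by (simp only: dist_norm norm_mult norm_of_real)
      also have "\<dots> = norm z - \<rho>"
        using False assms(4) \<open>z \<noteq> 0\<close> by (simp add: abs_if field_simps)
      finally show ?thesis .
    qed
    moreover have "of_real (\<rho> / norm z) * z \<in> cball 0 \<rho>"
      using False assms(4) by (auto simp: norm_mult norm_divide)
    ultimately have "z \<in> (\<Union>z\<in>cball 0 \<rho>. ball z \<epsilon>)"
      using that by (intro UN_I) auto
    with \<epsilon> show ?thesis by blast
  qed (use T_nonzero in blast)
  obtain g where g: "g holomorphic_on ball 0 (\<rho> + \<epsilon>)" 
    "\<And>z. z \<in> ball 0 (\<rho> + \<epsilon>) \<Longrightarrow> T z = g z ^ 2"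
    using contractible_imp_holomorphic_sqrt[OF T_holo, of "ball 0 (\<rho> + \<epsilon>)"] T_nonzero'
      convex_imp_contractible[OF convex_ball] by metis
  \<comment> \<open>As \<open>g 0\<close> is 1 or -1, this normalises the value at 0 to 1.\<close>
  define h where "h z = g z * g 0" for z
  have "T 0 = 1"
  proof -
    have "T 0 = 1 - 4 * index_poly a b K 0"
      using T[of 0] by simp
    then show ?thesis
      using assms(1) by (simp add: index_poly_0)
  qed
  then have g0: "g 0 * g 0 = 1"
    using g(2)[of 0] assms(4) \<epsilon>(1) by (simp add: power2_eq_square)
  have h_square: "h z ^ 2 = T z" if "z \<in> ball 0 (\<rho> + \<epsilon>)" for z
    using g(2)[OF that] g0 by (simp add: h_def power_mult_distrib power2_eq_square)
  have h_holo: "h holomorphic_on ball 0 (\<rho> + \<epsilon>)"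
    unfolding h_def by (intro holomorphic_intros g)
  define H where "H = disc_fps a b K * inverse (sqrt_fps \<rho>)"
  have sqrt_0: "fps_nth (sqrt_fps \<rho>) 0 = 1"
    by (simp add: sqrt_fps_def)
  then have disc_eq: "disc_fps a b K = sqrt_fps \<rho> * H"
    by (simp add: H_def inverse_mult_eq_1' mult.left_commute)
  have H_0: "fps_nth H 0 = 1"
    using sqrt_0 disc_fps_nth_0[OF assms(1)] by (simp add: H_def)
  have "sqrt_fps \<rho> ^ 2 * H ^ 2 = sqrt_fps \<rho> ^ 2 * TF"
    using disc_fps_square[OF assms(1), of b K] TF
    by (simp add: disc_eq power_mult_distrib sqrt_fps_square)
  moreover have "sqrt_fps \<rho> ^ 2 \<noteq> 0"
    using sqrt_0 by auto
  ultimately have H_square: "H ^ 2 = TF"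
    by simp
  have "T has_fps_expansion TF"
    unfolding T_def TF_def by (intro fps_expansion_intros)
  then have "h has_fps_expansion H"
    using assms(4) \<epsilon>(1) g0 H_0 H_square h_square
    by (intro has_fps_expansion_square_root[OF h_holo]) (auto simp: h_def)
  moreover have "h (of_real \<rho>) ^ 2 = of_real (4 * (\<Sum>j<K. real (a + b * j) * \<rho> ^ (a + b * j)))"
    using h_square[of "of_real \<rho>"] T_rho assms(4) \<epsilon>(1) by simp
  ultimately show ?thesis
    using that[of "\<rho> + \<epsilon>" h H] \<epsilon>(1) h_holo disc_eq by simp
qed

section \<open>Asymptotics\<close>

text \<open>
  The aperiodic case. The argument determines the limit only up to the sign of \<open>h \<rho>\<close>, whose square is known;
  the sign is positive because the counting sequence is nonnegative.
\<close>

lemma card_terms_asymptotics: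
  fixes a b m q :: nat
  defines "\<rho> \<equiv> \<xi> a b 0 (m + q)"
  assumes "1 \<le> a" "1 \<le> m + q" "period a b 0 (m + q) = 1"
  shows "(\<lambda>n. real (card (terms a b m q n)) * (\<rho> ^ n * (real n * sqrt (real n)))) \<longlonglongrightarrow>
    sqrt (\<Sum>j<m + q. real (a + b * j) * \<rho> ^ (a + b * j)) / (\<Prod>i<q. \<delta> a b 0 (m + i) \<rho>) / (2 * sqrt pi)"
proof -
  define K where "K = m + q"
  define S where "S = (\<Sum>j<K. real (a + b * j) * \<rho> ^ (a + b * j))"
  have K: "1 \<le> K" "period a b 0 K = 1"
    using assms by (simp_all add: K_def)
  have \<rho>: "0 < \<rho>" "index_poly a b K \<rho> = 1 / 4"
    using xi_root[of a 0 K b] assms by (simp_all add: K_def)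
  have "0 \<le> S"
    unfolding S_def using \<rho> by (intro sum_nonneg) auto

  \<comment> \<open>There is room to the right of \<open>\<rho>\<close>: at \<open>r1\<close> the radicands of index below \<open>K\<close> are still positive.\<close>
  have "index_poly a b (K - 1) \<rho> < index_poly a b K \<rho>"
  proof -
    have "{..<K} = insert (K - 1) {..<K - 1}"
      using assms by (auto simp: K_def)
    then show ?thesis
      using \<rho>(1) by (simp add: index_poly_def)
  qed
  then have "index_poly a b (K - 1) \<rho> < 1 / 4"
    using \<rho>(2) by simp
  moreover have "isCont (index_poly a b (K - 1) :: real \<Rightarrow> real) \<rho>"
    using continuous_index_poly[of UNIV] continuous_on_eq_continuous_at by blast
  ultimately have "\<forall>\<^sub>F x in at \<rho>. index_poly a b (K - 1) x < 1 / 4"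
    unfolding isCont_def by (intro order_tendstoD)
  then have "\<forall>\<^sub>F x in at_right \<rho>. index_poly a b (K - 1) x < 1 / 4"
    by (simp add: eventually_at_split)
  then obtain r1 where r1: "\<rho> < r1" "index_poly a b (K - 1) r1 < 1 / 4"
    using eventually_happens'[OF trivial_limit_at_right_real eventually_conj[OF _ eventually_at_right_less]]
    by blast
  have P_r1: "4 * index_poly a b k r1 < 1" if "k < K" for k
  proof -
    have "index_poly a b k r1 \<le> index_poly a b (K - 1) r1"
      using that \<rho>(1) r1(1) by (intro index_poly_mono_index) auto
    with r1(2) show ?thesis by linarith
  qed
  define f where "f k z = csqrt (1 - 4 * index_poly a b k z)" for k z
  have f: "f k has_fps_expansion disc_fps a b k" "f k holomorphic_on ball 0 r1"
      "\<And>z. z \<in> ball 0 r1 \<Longrightarrow> f k z \<noteq> 0" if "k < K" for k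
    using disc_fps_analytic[OF assms(2) _ P_r1[OF that]] \<rho>(1) r1(1) unfolding f_def by auto
  have inv_exp: "(\<lambda>z. inverse (f k z)) has_fps_expansion inverse (disc_fps a b k)" if "k < K" for k
    using f[OF that] disc_fps_nth_0[OF assms(2)] by (intro fps_expansion_intros) auto
  have inv_holo: "(\<lambda>z. inverse (f k z)) holomorphic_on ball 0 r1" if "k < K" for k
    using f[OF that] by (intro holomorphic_intros) auto
  have rad_disc: "ereal r1 \<le> fps_conv_radius (disc_fps a b k)" if "k < K" for k
    using f[OF that] by (intro holomorphic_on_imp_fps_conv_radius_ge) auto
  have rad_inv: "ereal r1 \<le> fps_conv_radius (inverse (disc_fps a b k))" if "k < K" for k
    using inv_exp[OF that] inv_holo[OF that] by (intro holomorphic_on_imp_fps_conv_radius_ge) auto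

  define A where "A = (\<Prod>i<q. inverse (disc_fps a b (m + i)))"
  define fA where "fA z = (\<Prod>i<q. inverse (f (m + i) z))" for z
  have fA: "fA has_fps_expansion A" "fA holomorphic_on ball 0 r1"
  proof -
    have less: "m + i < K" if "i \<in> {..<q}" for i
      using that by (simp add: K_def)
    show "fA has_fps_expansion A"
      unfolding A_def fA_def using less by (intro has_fps_expansion_prod inv_exp)
    show "fA holomorphic_on ball 0 r1"
      unfolding fA_def using less by (intro holomorphic_on_prod inv_holo)
  qed
  have rad_A: "ereal r1 \<le> fps_conv_radius A"
    using fA by (intro holomorphic_on_imp_fps_conv_radius_ge) auto
  define R where "R = term_fps a b m q - A * term_fps a b K 0"
  have rad_R: "ereal r1 \<le> fps_conv_radius R"
    unfolding R_def A_def by (rule fps_conv_radius_term_fps_remainder[OF assms(2) rad_disc rad_inv])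
      (simp_all add: K_def)

  obtain r h H where h: "\<rho> < r" "h holomorphic_on ball 0 r" "h has_fps_expansion H"
    "disc_fps a b K = sqrt_fps \<rho> * H" "h (of_real \<rho>) ^ 2 = of_real (4 * S)"
    using disc_fps_singular_factor[OF assms(2) K \<rho>] unfolding S_def by blast
  define r2 where "r2 = min r r1"
  have r2: "\<rho> < r2" "r2 \<le> r" "r2 \<le> r1"
    using h(1) r1 by (auto simp: r2_def)
  define B where "B = - (fps_const (1 / 2) * A * H)"
  have B_exp: "(\<lambda>z. - (1 / 2 * fA z * h z)) has_fps_expansion B"
    unfolding B_def by (intro fps_expansion_intros fA h)
  have "fA holomorphic_on ball 0 r2" "h holomorphic_on ball 0 r2"
    using r2 by (auto intro: holomorphic_on_subset[OF fA(2)] holomorphic_on_subset[OF h(2)])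
  then have B_holo: "(\<lambda>z. - (1 / 2 * fA z * h z)) holomorphic_on ball 0 r2"
    by (intro holomorphic_intros)
  have "ereal r2 \<le> fps_conv_radius B"
    using B_exp B_holo by (intro holomorphic_on_imp_fps_conv_radius_ge) auto
  then have rad_B: "ereal \<rho> < fps_conv_radius B"
    using r2(1) by (simp add: less_le_trans[rotated])
  have B_eval: "eval_fps B (of_real \<rho>) = - (1 / 2 * fA (of_real \<rho>) * h (of_real \<rho>))"
    using r2(1) \<rho>(1) by (intro has_fps_expansion_imp_eval_fps_eq[OF B_exp _ B_holo]) simp
  define R' where "R' = R + fps_const (1 / 2) * A"
  have "ereal r1 \<le> fps_conv_radius R'"
    unfolding R'_def by (intro fps_conv_radius_add_ge fps_conv_radius_mult_ge rad_A rad_R) simp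
  then have rad_R': "ereal \<rho> < fps_conv_radius R'"
    using r1(1) by (simp add: less_le_trans[rotated])

  have "fps_const (2 :: complex) * term_fps a b K 0 = 1 - sqrt_fps \<rho> * H"
    unfolding h(4)[symmetric] by (simp add: disc_fps_def numeral_fps_const)
  then have "fps_const (1 / 2) * (fps_const (2 :: complex) * term_fps a b K 0) =
      fps_const (1 / 2) * (1 - sqrt_fps \<rho> * H)"
    by simp
  then have half: "term_fps a b K 0 = fps_const (1 / 2) * (1 - sqrt_fps \<rho> * H)"
    by (simp flip: mult.assoc)
  have "term_fps a b m q = A * term_fps a b K 0 + R"
    by (simp add: R_def)
  then have decomp: "term_fps a b m q = B * sqrt_fps \<rho> + R'"
    unfolding half B_def R'_def by (simp add: algebra_simps)

  define x where "x n = real (card (terms a b m q n)) * (\<rho> ^ n * (real n * sqrt (real n)))" for n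
  define l where "l = fA (of_real \<rho>) * h (of_real \<rho>) / of_real (4 * sqrt pi)"
  have "(\<lambda>n. fps_nth (B * sqrt_fps \<rho>) n * of_real (\<rho> ^ n * (real n * sqrt (real n))) +
      fps_nth R' n * of_real (\<rho> ^ n * (real n * sqrt (real n)))) \<longlonglongrightarrow>
      eval_fps B (of_real \<rho>) * of_real (- 1 / (2 * sqrt pi)) + 0"
    by (intro tendsto_add coeff_limit_mult coeff_limit_sqrt_fps coeff_limit_0 \<rho> rad_B rad_R')
  also have "eval_fps B (of_real \<rho>) * of_real (- 1 / (2 * sqrt pi)) + 0 = l"
    by (simp add: B_eval l_def)
  also have "(\<lambda>n. fps_nth (B * sqrt_fps \<rho>) n * of_real (\<rho> ^ n * (real n * sqrt (real n))) +
      fps_nth R' n * of_real (\<rho> ^ n * (real n * sqrt (real n)))) = (\<lambda>n. of_real (x n))"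
  proof
    fix n
    have "fps_nth (B * sqrt_fps \<rho>) n + fps_nth R' n = of_nat (card (terms a b m q n))"
      unfolding fps_add_nth[symmetric] decomp[symmetric] by (simp add: term_fps_def)
    then show "fps_nth (B * sqrt_fps \<rho>) n * of_real (\<rho> ^ n * (real n * sqrt (real n))) +
        fps_nth R' n * of_real (\<rho> ^ n * (real n * sqrt (real n))) = of_real (x n)"
      by (simp add: x_def flip: distrib_right)
  qed
  finally have lim: "(\<lambda>n. complex_of_real (x n)) \<longlonglongrightarrow> l" .

  \<comment> \<open>The limit \<open>l\<close> of nonnegative real numbers is real and nonnegative.\<close>
  have x_lim: "x \<longlonglongrightarrow> Re l"
    using tendsto_Re[OF lim] by simp
  have "(\<lambda>n. 0) \<longlonglongrightarrow> Im l"
    using tendsto_Im[OF lim] by simp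
  then have "Im l = 0"
    by (simp add: LIMSEQ_const_iff)
  have "0 \<le> Re l"
    using x_lim \<rho>(1) by (intro LIMSEQ_le_const[OF x_lim]) (auto simp: x_def)

  define \<alpha> where "\<alpha> = (\<Prod>i<q. \<delta> a b 0 (m + i) \<rho>)"
  have \<alpha>: "0 < \<alpha>" "fA (of_real \<rho>) = of_real (1 / \<alpha>)"
  proof -
    have pos: "0 < 1 - 4 * index_poly a b k \<rho>" if "k < K" for k
    proof (cases "k = 0")
      case False
      then have "index_poly a b k \<rho> < index_poly a b k r1"
        using assms(2) \<rho>(1) r1(1) by (intro index_poly_strict_mono) auto
      then show ?thesis
        using P_r1[OF that] by simp
    qed (simp add: index_poly_def)
    then show "0 < \<alpha>"
      unfolding \<alpha>_def by (intro prod_pos) (auto simp: \<delta>_def radicand_eq K_def)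
    have f_eq: "f k (of_real \<rho>) = of_real (\<delta> a b 0 k \<rho>)" if "k < K" for k
    proof -
      have "(1 - 4 * index_poly a b k (of_real \<rho>) :: complex) = of_real (1 - 4 * index_poly a b k \<rho>)"
        by (simp add: index_poly_def)
      then have "f k (of_real \<rho>) = csqrt (of_real (1 - 4 * index_poly a b k \<rho>))"
        by (simp only: f_def)
      then show ?thesis
        using pos[OF that] by (simp add: \<delta>_def radicand_eq del: of_real_diff of_real_mult)
    qed
    have "fA (of_real \<rho>) = (\<Prod>i<q. 1 / of_real (\<delta> a b 0 (m + i) \<rho>))"
      unfolding fA_def by (intro prod.cong refl) (simp add: f_eq K_def inverse_eq_divide)
    then show "fA (of_real \<rho>) = of_real (1 / \<alpha>)"
      by (simp add: \<alpha>_def prod_dividef)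
  qed
  have "h (of_real \<rho>) = of_real (4 * sqrt pi * \<alpha>) * l"
    using \<alpha> by (simp add: l_def)
  also have "l = of_real (Re l)"
    using \<open>Im l = 0\<close> by (simp add: complex_eq_iff)
  finally have h_real: "h (of_real \<rho>) = of_real (4 * sqrt pi * \<alpha> * Re l)"
    by simp
  then have "complex_of_real ((4 * sqrt pi * \<alpha> * Re l) ^ 2) = of_real (4 * S)"
    using h(5) by simp
  then have "(4 * sqrt pi * \<alpha> * Re l) ^ 2 = 4 * S"
    unfolding of_real_eq_iff .
  moreover have "0 \<le> 4 * sqrt pi * \<alpha> * Re l"
    using \<alpha>(1) \<open>0 \<le> Re l\<close> by simp
  ultimately have "4 * sqrt pi * \<alpha> * Re l = sqrt (4 * S)"
    by (metis real_sqrt_unique)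
  then have "Re l = sqrt S / \<alpha> / (2 * sqrt pi)"
    using \<alpha>(1) by (simp add: real_sqrt_mult field_simps)
  then show ?thesis
    using x_lim unfolding x_def S_def \<alpha>_def K_def by simp
qed

text \<open>
  For \<open>K = 1\<close> the period \<open>a + d\<close> need not divide \<open>b\<close>, and \<open>b' = b div p\<close> is a dummy value: the
  only index weight then is the one for \<open>j = 0\<close>.
\<close>

lemma period_divisor:
  fixes a b d K :: nat
  assumes "1 \<le> a + d" "1 \<le> K"
  defines "p \<equiv> period a b d K"
  obtains a' b' where "1 \<le> p" "1 \<le> a'" "period a' b' 0 K = 1"
    and "\<And>j. j < K \<Longrightarrow> (a + d) + b * j = p * (a' + b' * j)"
proof -
  have dvd: "p dvd a + d + b * j" if "j < K" for j
    unfolding p_def period_def using that by (intro Gcd_dvd) auto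
  have p: "p dvd a + d"
    using dvd[of 0] assms(2) by simp
  then have "1 \<le> p"
    using assms(1) by (cases p) auto
  define a' where "a' = (a + d) div p"
  define b' where "b' = b div p"
  have a': "a + d = p * a'"
    using p by (simp add: a'_def)
  have eq: "(a + d) + b * j = p * (a' + b' * j)" if "j < K" for j
  proof (cases "j = 0")
    case False
    then have "p dvd a + d + b"
      using dvd[of 1] that by simp
    then have "p dvd b"
      using p by (simp add: dvd_add_right_iff)
    then show ?thesis
      by (simp add: a' b'_def algebra_simps)
  qed (simp add: a')
  have "p = Gcd ((\<lambda>j. p * (a' + b' * j)) ` {..<K})"
    unfolding p_def period_def using eq by (intro arg_cong[of _ _ Gcd] image_cong) (auto simp: p_def period_def)
  also have "\<dots> = p * period a' b' 0 K"
    using Gcd_mult[of p "(\<lambda>j. a' + b' * j) ` {..<K}"] by (simp add: period_def image_image)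
  finally have "period a' b' 0 K = 1"
    using \<open>1 \<le> p\<close> by simp
  then show ?thesis
    using that[of a' b'] \<open>1 \<le> p\<close> a' assms(1) eq by (cases a') auto
qed

text \<open>
  For \<open>m + q = 1\<close> the bound in the definition of expressibility leaves only \<open>x = 0\<close>, which compensates
  for \<open>p\<close> not dividing \<open>b\<close>.
\<close>

lemma expressible_multiple:
  assumes "expressible a b c d m q n" "1 \<le> m + q"
    and scale: "\<And>j. j < m + q \<Longrightarrow> (a + d) + b * j = p * (a' + b' * j)"
  shows "\<exists>t. n + d = p * t + c * q"
proof -
  obtain x y where n: "n = (y + 1) * a + x * b + q * c + y * d"
    and x: "int x \<le> (int m - 1 + int q) * (int y + 1)"
    using assms(1) unfolding expressible_def by blast
  have ad: "a + d = p * a'"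
    using scale[of 0] assms(2) by (simp add: Suc_le_eq)
  have "x * b = p * (x * b')"
  proof (cases "m + q = 1")
    case True
    then have "int m - 1 + int q = 0"
      by linarith
    with x show ?thesis by simp
  next
    case False
    then have "b = p * b'"
      using scale[of 1] assms(2) by (simp add: ad algebra_simps)
    then show ?thesis by simp
  qed
  have "n + d = p * ((y + 1) * a' + x * b') + c * q"
  proof -
    have "n + d = (y + 1) * (a + d) + x * b + c * q"
      by (simp add: n algebra_simps)
    also have "\<dots> = (y + 1) * (p * a') + p * (x * b') + c * q"
      using ad \<open>x * b = p * (x * b')\<close> by simp
    also have "\<dots> = p * ((y + 1) * a' + x * b') + c * q"
      by (simp add: algebra_simps)
    finally show ?thesis .
  qed
  then show ?thesis ..
qed

text \<open>
  Along the expressible sizes \<open>n\<close>, the count is the one of the aperiodic problem at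
  \<open>t n = (n + d - c * q) / p\<close>, whose singularity is \<open>\<rho> = \<xi> a b d (m + q) ^ p\<close>. Expressing the latter's asymptotics
  through \<open>n\<close> leaves the quotient of \<open>n powr (3 / 2)\<close> and \<open>(n + d - c * q) powr (3 / 2)\<close>, which tends to 1.
\<close>

lemma L_asymptotics:
  fixes a b c d m q :: nat
  assumes "1 \<le> a + d" "1 \<le> m + q"
  defines "F \<equiv> inf at_top (principal {n. expressible a b c d m q n})"
  shows "(\<lambda>n. real (L a b c d m q n)) \<sim>[F]
    (\<lambda>n. real (period a b d (m + q)) *
      (C a b c d m q * \<xi> a b d (m + q) powi (- int n) / (2 * sqrt (pi * real n ^ 3))))"
    (is "_ \<sim>[F] ?G")
proof (rule asymp_equivI')
  define K where "K = m + q"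
  define p where "p = period a b d K"
  obtain a' b' where p: "1 \<le> p" and a': "1 \<le> a'" and period: "period a' b' 0 K = 1"
    and scale: "\<And>j. j < K \<Longrightarrow> (a + d) + b * j = p * (a' + b' * j)"
    using period_divisor[OF assms(1,2), of b] unfolding p_def K_def by blast
  define \<xi>\<^sub>K where "\<xi>\<^sub>K = \<xi> a b d K"
  define \<rho> where "\<rho> = \<xi>\<^sub>K ^ p"
  have \<xi>\<^sub>K: "0 < \<xi>\<^sub>K" "index_poly (a + d) b K \<xi>\<^sub>K = 1 / 4"
    using xi_root[of a d K b] assms(1,2) by (simp_all add: K_def \<xi>\<^sub>K_def)
  have index_poly_scale: "index_poly (a + d) b k z = index_poly a' b' k (z ^ p)" if "k \<le> K" for k and z :: real
    unfolding index_poly_def using that scale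
    by (intro sum.cong) (auto simp flip: power_mult)
  have "0 < \<rho>"
    using \<xi>\<^sub>K(1) by (simp add: \<rho>_def)
  have \<rho>_eq: "\<xi> a' b' 0 K = \<rho>"
    using a' assms(2) \<xi>\<^sub>K \<open>0 < \<rho>\<close> index_poly_scale[of K \<xi>\<^sub>K]
    by (intro xi_eqI) (auto simp: K_def \<rho>_def)
  have \<delta>_eq: "\<delta> a' b' 0 k \<rho> = \<delta> a b d k \<xi>\<^sub>K" if "k \<le> K" for k
    using index_poly_scale[OF that, of \<xi>\<^sub>K] by (simp add: \<delta>_def radicand_eq \<rho>_def)

  define S where "S = (\<Sum>j<K. real (a' + b' * j) * \<rho> ^ (a' + b' * j))"
  have "0 < S"
    unfolding S_def using \<open>0 < \<rho>\<close> a' assms(2)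
    by (intro sum_pos mult_pos_pos zero_less_power)
      (auto simp: lessThan_empty_iff K_def intro: add_pos_nonneg)
  have S_eq: "\<xi>\<^sub>K ^ (a + d) * (\<Sum>j<K. real (a + d + b * j) * \<xi>\<^sub>K ^ (b * j)) = real p * S"
  proof -
    have "\<xi>\<^sub>K ^ (a + d) * (\<Sum>j<K. real (a + d + b * j) * \<xi>\<^sub>K ^ (b * j)) =
        (\<Sum>j<K. real (a + d + b * j) * \<xi>\<^sub>K ^ (a + d + b * j))"
      by (simp add: sum_distrib_left power_add mult_ac)
    also have "\<dots> = (\<Sum>j<K. real p * (real (a' + b' * j) * \<rho> ^ (a' + b' * j)))"
      using scale by (intro sum.cong) (auto simp: \<rho>_def simp flip: power_mult)
    finally show ?thesis
      by (simp add: S_def sum_distrib_left)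
  qed
  define \<alpha> where "\<alpha> = (\<Prod>i<q. \<delta> a b d (m + i) \<xi>\<^sub>K)"
  have \<alpha>_eq: "(\<Prod>i<q. \<delta> a' b' 0 (m + i) \<rho>) = \<alpha>"
    unfolding \<alpha>_def by (intro prod.cong refl \<delta>_eq) (simp add: K_def)
  have "0 < \<alpha>"
    unfolding \<alpha>_def
  proof (intro prod_pos ballI)
    fix i assume "i \<in> {..<q}"
    then have "{..<K} = insert (K - 1) {..<K - 1}" "m + i \<le> K - 1"
      by (auto simp: K_def)
    then have "index_poly (a + d) b (m + i) \<xi>\<^sub>K < index_poly (a + d) b K \<xi>\<^sub>K"
      using index_poly_mono_index[of \<xi>\<^sub>K "m + i" "K - 1" "a + d" b] \<xi>\<^sub>K(1)
      by (simp add: index_poly_def add_pos_nonneg le_less_trans)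
    then show "0 < \<delta> a b d (m + i) \<xi>\<^sub>K"
      by (simp add: \<delta>_def radicand_eq \<xi>\<^sub>K(2))
  qed
  define \<kappa> where "\<kappa> = sqrt S / \<alpha> / (2 * sqrt pi)"
  have "0 < \<kappa>"
    using \<open>0 < S\<close> \<open>0 < \<alpha>\<close> by (simp add: \<kappa>_def)
  define w where "w x = x * sqrt x" for x :: real
  define g where "g s = real (card (terms a' b' m q s)) * (\<rho> ^ s * w (real s))" for s
  have g_lim: "g \<longlonglongrightarrow> \<kappa>"
    using card_terms_asymptotics[of a' m q b'] a' assms(2) period
    unfolding g_def w_def \<kappa>_def K_def[symmetric] \<rho>_eq \<alpha>_eq S_def[symmetric] by simp

  define t where "t n = (n + d - c * q) div p" for n
  have t_lim: "filterlim t at_top F"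
  proof -
    have "filterlim t at_top at_top"
      unfolding filterlim_at_top
    proof
      fix Z
      show "\<forall>\<^sub>F n in at_top. Z \<le> t n"
        using eventually_ge_at_top[of "p * Z + c * q"]
      proof eventually_elim
        case (elim n)
        then have "p * Z div p \<le> t n"
          unfolding t_def by (intro div_le_mono) simp
        then show ?case
          using p by simp
      qed
    qed
    then show ?thesis
      unfolding F_def by (rule filterlim_mono) auto
  qed
  define D where "D = real d - real (c * q)"
  have "(\<lambda>n. w (real n) / w (real n + D)) \<longlonglongrightarrow> 1"
    unfolding w_def by real_asymp
  then have "((\<lambda>n. w (real n) / w (real n + D)) \<longlongrightarrow> 1) F"
    unfolding F_def by (rule filterlim_mono) auto
  then have "((\<lambda>n. g (t n) / \<kappa> * (w (real n) / w (real n + D))) \<longlongrightarrow> \<kappa> / \<kappa> * 1) F"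
    using \<open>0 < \<kappa>\<close> by (intro tendsto_intros filterlim_compose[OF g_lim t_lim]) auto
  then have "((\<lambda>n. g (t n) / \<kappa> * (w (real n) / w (real n + D))) \<longlongrightarrow> 1) F"
    using \<open>0 < \<kappa>\<close> by simp
  then show "((\<lambda>n. real (L a b c d m q n) / ?G n) \<longlongrightarrow> 1) F"
  proof (rule Lim_transform_eventually)
    have "\<forall>\<^sub>F n in F. 0 < n"
      unfolding F_def using eventually_gt_at_top[of 0] by (rule filter_leD[OF inf_le1])
    moreover have "\<forall>\<^sub>F n in F. expressible a b c d m q n"
      unfolding F_def by (rule filter_leD[OF inf_le2]) (simp add: eventually_principal)
    moreover have "\<forall>\<^sub>F n in F. 0 < t n"
      using t_lim[unfolded filterlim_at_top, rule_format, of 1] by eventually_elim simp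
    ultimately show "\<forall>\<^sub>F n in F. g (t n) / \<kappa> * (w (real n) / w (real n + D)) =
        real (L a b c d m q n) / ?G n"
    proof eventually_elim
      case (elim n)
      obtain s where s: "n + d = p * s + c * q"
        using expressible_multiple[OF elim(2) assms(2)] scale unfolding K_def by metis
      then have "t n = s"
        using p by (simp add: t_def)
      have L_eq: "L a b c d m q n = card (terms a' b' m q s)"
        using L_eq_card_terms[OF s] terms_scale[of m q "a + d" b p a' b' s] scale p
        by (simp add: K_def)
      have "real n + D = real p * real s"
        using arg_cong[OF s, of real] by (simp add: D_def)
      then have w_eq: "w (real n + D) = real p * sqrt (real p) * w (real s)"
        by (simp add: w_def real_sqrt_mult)
      have sqrt_eq: "sqrt (pi * real n ^ 3) = sqrt pi * w (real n)"
      proof -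
        have "real n ^ 3 = real n ^ 2 * real n"
          by (simp add: power3_eq_cube power2_eq_square)
        then show ?thesis
          by (simp add: w_def real_sqrt_mult)
      qed
      have exponent: "\<xi>\<^sub>K powi (int (c * q) - int d) * \<xi>\<^sub>K powi (- int n) = 1 / \<rho> ^ s"
      proof -
        have "\<xi>\<^sub>K powi (int (c * q) - int d) * \<xi>\<^sub>K powi (- int n) =
            \<xi>\<^sub>K powi (int (c * q) - int d + (- int n))"
          using \<xi>\<^sub>K(1) by (intro power_int_add[symmetric]) simp
        also have "int (c * q) - int d + (- int n) = - int (p * s)"
          using arg_cong[OF s, of int] by simp
        also have "\<xi>\<^sub>K powi (- int (p * s)) = inverse (\<xi>\<^sub>K ^ (p * s))"
          by (simp only: power_int_minus power_int_of_nat)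
        finally show ?thesis
          by (simp add: \<rho>_def power_mult inverse_eq_divide)
      qed
      have C_eq: "C a b c d m q = \<xi>\<^sub>K powi (int (c * q) - int d) * sqrt (real p * S) / \<alpha>"
        unfolding C_def Let_def K_def[symmetric] \<xi>\<^sub>K_def[symmetric] S_eq \<alpha>_def ..
      have "?G n = real p * ((\<xi>\<^sub>K powi (int (c * q) - int d) * \<xi>\<^sub>K powi (- int n)) *
          sqrt (real p * S) / \<alpha> / (2 * (sqrt pi * w (real n))))"
        unfolding C_eq sqrt_eq K_def[symmetric] p_def[symmetric] \<xi>\<^sub>K_def[symmetric]
        by (simp add: mult_ac)
      also have "\<dots> = real p * sqrt (real p) * \<kappa> / (\<rho> ^ s * w (real n))"
        unfolding exponent \<kappa>_def by (simp add: real_sqrt_mult mult_ac)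
      finally have G_eq: "?G n = real p * sqrt (real p) * \<kappa> / (\<rho> ^ s * w (real n))" .
      have "0 < w (real s)"
        using elim(3) \<open>t n = s\<close> by (simp add: w_def)
      then show ?case
        unfolding G_eq L_eq w_eq \<open>t n = s\<close> g_def using p \<open>0 < \<kappa>\<close> \<open>0 < \<rho>\<close>
        by (simp add: field_simps)
    qed
  qed
qed

theorem lemma10:
  fixes a b c d m q :: nat
  assumes "a + d \<ge> 1" and "b \<ge> 1" and "c \<ge> 1" and "gcd b (gcd c (a + d)) = 1"
  shows "(\<forall>n>0. (m = 0 \<and> q = 0) \<or> \<not> expressible a b c d m q n \<longrightarrow> L a b c d m q n = 0) \<and>
         (\<not> (m = 0 \<and> q = 0) \<longrightarrow>
           asymp_equiv (\<lambda>n. real (L a b c d m q n))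
             (inf at_top (principal {n. expressible a b c d m q n}))
             (\<lambda>n. real (period a b d (m + q)) *
               (C a b c d m q * \<xi> a b d (m + q) powi (- int n) / (2 * sqrt (pi * real n ^ 3)))))"
proof (intro conjI allI impI)
  fix n :: nat
  assume "(m = 0 \<and> q = 0) \<or> \<not> expressible a b c d m q n"
  then have "{M. m_open m M \<and> abstractions M = q \<and> term_size a b c d M = n} = {}"
    using expressible_term_size by fastforce
  then show "L a b c d m q n = 0"
    unfolding L_def by (simp only: card.empty)
next
  assume "\<not> (m = 0 \<and> q = 0)"
  then have "1 \<le> m + q"
    by (simp add: Suc_le_eq)
  with assms(1) show "asymp_equiv (\<lambda>n. real (L a b c d m q n))
             (inf at_top (principal {n. expressible a b c d m q n}))
             (\<lambda>n. real (period a b d (m + q)) *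
               (C a b c d m q * \<xi> a b d (m + q) powi (- int n) / (2 * sqrt (pi * real n ^ 3))))"
    by (rule L_asymptotics)
qed

end
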